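(* Let $X\sim(B,\sigma^2)$ with $\mathcal{G}(B)$ a directed acyclic graph, and let $j\in V$. If $\mathrm{pa}(j)=\emptyset$, then $\mathrm{var}(X_j)=\sigma^2$. If $\mathrm{pa}(j)\neq\emptyset$, then $\mathrm{var}(X_j)\ge\sigma^2(1+\zeta)>\sigma^2$.
   Context: Let $V=\{1,\dots,p\}$. For a real $p\times p$ matrix $B=(\beta_{jk})$ with zero diagonal and $\sigma^2>0$, write $X\sim(B,\sigma^2)$ if the random vector $X=(X_1,\dots,X_p)$ solves $X_j=\sum_{k\neq j}\beta_{jk}X_k+\varepsilon_j$, $j=1,\dots,p$, for independent mean-zero random variables $\varepsilon_1,\dots,\varepsilon_p$ all having the same variance $\sigma^2$. $\mathcal{G}(B)$ is the directed graph with vertex set $V$ and edge set $E(B)=\{(k,j):\beta_{jk}\neq 0\}$, where $(k,j)$ is the edge $k\to j$. $\mathrm{pa}(j)=\{k:(k,j)\in E(B)\}$ is the set of parents of $j$. Define $\zeta=\min_{(k,j)\in E(B)}\beta_{jk}^2$ (only used when $E(B)\neq\emptyset$). *)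

theory Defs
  imports "HOL-Probability.Probability"
begin

text \<open>
  The vertex set \<open>V = {1, ..., p}\<close> is the finite index type \<open>'p\<close>. The entry
  \<open>B $ j $ k\<close> is the coefficient of the edge from \<open>k\<close> to \<open>j\<close>, so the
  indices are swapped with respect to the pair \<open>(k, j)\<close> that denotes the edge.
\<close>

definition edges :: "real ^ 'p ^ 'p \<Rightarrow> ('p \<times> 'p) set"
  where "edges B = {(k, j). B $ j $ k \<noteq> 0}"

definition pa :: "real ^ 'p ^ 'p \<Rightarrow> 'p \<Rightarrow> 'p set"
  where "pa B j = {k. (k, j) \<in> edges B}"

text \<open>\<open>zeta B\<close> is unspecified if there are no edges.\<close>

definition zeta :: "real ^ ('p::finite) ^ 'p \<Rightarrow> real"
  where "zeta B = Min ((\<lambda>(k, j). (B $ j $ k)\<^sup>2) ` edges B)"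

text \<open>
  The relation \<open>X \<sim> (B, \<sigma>\<^sup>2)\<close>; the argument \<open>v\<close> is the common error variance
  \<open>\<sigma>\<^sup>2\<close> itself. Square integrability of the errors is stated explicitly because
  the Bochner integral of a non-integrable function is \<open>0\<close>. The structural
  equations are required almost surely.
\<close>

definition (in prob_space) equal_var_sem ::
    "('a \<Rightarrow> real ^ ('p::finite)) \<Rightarrow> real ^ 'p ^ 'p \<Rightarrow> real \<Rightarrow> bool"
  where "equal_var_sem X B v \<longleftrightarrow>
    (\<forall>j. B $ j $ j = 0) \<and> v > 0 \<and> random_variable borel X \<and>
    (\<exists>\<epsilon> :: 'p \<Rightarrow> 'a \<Rightarrow> real.
      indep_vars (\<lambda>_. borel) \<epsilon> UNIV \<and>
      (\<forall>j. integrable M (\<epsilon> j) \<and> integrable M (\<lambda>\<omega>. (\<epsilon> j \<omega>)\<^sup>2) \<and>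
           expectation (\<epsilon> j) = 0 \<and> variance (\<epsilon> j) = v) \<and>
      (AE \<omega> in M. \<forall>j. X \<omega> $ j = (\<Sum>k\<in>UNIV - {j}. B $ j $ k * X \<omega> $ k) + \<epsilon> j \<omega>))"

end

theory Submission imports Defs begin

text \<open>
  Solving the structural equations along the acyclic graph writes \<open>X\<^sub>j\<close> as a linear combination
  \<open>\<Sum>k. c k * \<epsilon>\<^sub>k\<close> of the errors with \<open>c j = 1\<close> and \<open>c k \<noteq> 0\<close> only for ancestors \<open>k\<close> of \<open>j\<close>, so
  that \<open>var X\<^sub>j = \<sigma>\<^sup>2 * (\<Sum>k. (c k)\<^sup>2)\<close>. If \<open>j\<close> has parents, take a parent \<open>k\<close> that is an
  ancestor of no other parent: the only directed path from \<open>k\<close> to \<open>j\<close> is the edge itself, whence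
  \<open>c k = B $ j $ k\<close> and \<open>(c k)\<^sup>2 \<ge> zeta B\<close>.
\<close>

text \<open>Expanding the square gives a double sum of products \<open>Y i * Y k\<close>.
  Independence and mean zero kill the off-diagonal expectations, so only the \<open>n\<close>-th
  diagonal terms \<open>(c i)\<^sup>2 * v\<close> remain, one for each index.\<close>

lemma (in prob_space) indep_vars_linear_combination:
  fixes Y :: "'i \<Rightarrow> 'a \<Rightarrow> real"
  assumes fin: "finite I" and indep: "indep_vars (\<lambda>_. borel) Y I"
    and int: "\<And>i. i \<in> I \<Longrightarrow> integrable M (Y i)"
    and int2: "\<And>i. i \<in> I \<Longrightarrow> integrable M (\<lambda>\<omega>. (Y i \<omega>)\<^sup>2)"
    and mean: "\<And>i. i \<in> I \<Longrightarrow> expectation (Y i) = 0"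
    and var: "\<And>i. i \<in> I \<Longrightarrow> variance (Y i) = v"
  shows "expectation (\<lambda>\<omega>. \<Sum>i\<in>I. c i * Y i \<omega>) = 0"
    and "variance (\<lambda>\<omega>. \<Sum>i\<in>I. c i * Y i \<omega>) = v * (\<Sum>i\<in>I. (c i)\<^sup>2)"
proof -
  show mean0: "expectation (\<lambda>\<omega>. \<Sum>i\<in>I. c i * Y i \<omega>) = 0"
    using int mean by (subst Bochner_Integration.integral_sum) auto
  have prod: "integrable M (\<lambda>\<omega>. Y i \<omega> * Y k \<omega>) \<and>
      expectation (\<lambda>\<omega>. Y i \<omega> * Y k \<omega>) = (if i = k then v else 0)"
    if "i \<in> I" "k \<in> I" for i k
  proof (cases "i = k")
    case True
    then show ?thesis
      using int2[OF that(1)] var[OF that(1)] mean[OF that(1)] by (simp add: power2_eq_square)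
  next
    case False
    \<comment> \<open>Restricting the family to the pair \<open>{i, k}\<close> makes
      \<open>Y i * Y k\<close> a product over an independent family, so it is integrable and its
      expectation factors.\<close>
    have sub: "indep_vars (\<lambda>_. borel) Y {i, k}"
      using indep that by (auto intro: indep_vars_subset)
    have "integrable M (\<lambda>\<omega>. \<Prod>l\<in>{i, k}. Y l \<omega>)"
      using that int by (intro indep_vars_integrable[OF _ sub]) auto
    moreover have "(\<integral>\<omega>. (\<Prod>l\<in>{i, k}. Y l \<omega>) \<partial>M) = (\<Prod>l\<in>{i, k}. \<integral>\<omega>. Y l \<omega> \<partial>M)"
      using that int by (intro indep_vars_lebesgue_integral[OF _ sub]) auto
    ultimately show ?thesis
      using False that mean by simp
  qed
  have "variance (\<lambda>\<omega>. \<Sum>i\<in>I. c i * Y i \<omega>)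
      = expectation (\<lambda>\<omega>. \<Sum>i\<in>I. \<Sum>k\<in>I. (c i * c k) * (Y i \<omega> * Y k \<omega>))"
    unfolding mean0 by (simp add: power2_eq_square sum_product mult_ac)
  also have "\<dots> = (\<Sum>i\<in>I. \<Sum>k\<in>I. (c i * c k) * expectation (\<lambda>\<omega>. Y i \<omega> * Y k \<omega>))"
    using prod by (simp add: Bochner_Integration.integral_sum)
  also have "\<dots> = (\<Sum>i\<in>I. \<Sum>k\<in>I. if i = k then v * (c i)\<^sup>2 else 0)"
    using prod by (intro sum.cong) (auto simp: power2_eq_square)
  also have "\<dots> = v * (\<Sum>i\<in>I. (c i)\<^sup>2)"
    using fin by (simp add: sum_distrib_left)
  finally show "variance (\<lambda>\<omega>. \<Sum>i\<in>I. c i * Y i \<omega>) = v * (\<Sum>i\<in>I. (c i)\<^sup>2)" .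
qed

text \<open>The statement is deterministic and chooses \<open>c\<close> before \<open>x\<close> and
  \<open>e\<close>, so a single coefficient vector serves at almost every outcome. Well-founded
  induction along the edges substitutes the expansions of the parents into the equation for
  \<open>j\<close>.\<close>

lemma acyclic_structural_equations_solution:
  fixes B :: "real ^ ('p::finite) ^ 'p"
  assumes acyc: "acyclic (edges B)"
  shows "\<exists>c. (\<forall>(x :: real ^ 'p) e. (\<forall>i. x $ i = (\<Sum>k\<in>UNIV - {i}. B $ i $ k * x $ k) + e i)
              \<longrightarrow> x $ j = (\<Sum>k\<in>UNIV. c k * e k)) \<and>
           c j = 1 \<and> (\<forall>k. c k \<noteq> 0 \<longrightarrow> (k, j) \<in> (edges B)\<^sup>*) \<and>
           (pa B j \<noteq> {} \<longrightarrow> (\<exists>k\<in>pa B j. c k = B $ j $ k))"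
    (is "\<exists>c. ?P j c")
proof -
  have wf: "wf (edges B)"
    using acyc by (simp add: finite_acyclic_wf)
  show ?thesis
    using wf
  proof (induction j)
    case (less j)
    have "\<exists>c. ?P l c" if "l \<in> pa B j" for l
    proof (rule less)
      show "(l, j) \<in> edges B"
        using that by (simp add: pa_def)
    qed
    then have "\<forall>l\<in>pa B j. \<exists>c. ?P l c" ..
    from bchoice[OF this] obtain A where "\<forall>l\<in>pa B j. ?P l (A l)" ..
    then have A_solution: "\<And>l (x :: real ^ 'p) e. l \<in> pa B j \<Longrightarrow>
          (\<forall>i. x $ i = (\<Sum>k\<in>UNIV - {i}. B $ i $ k * x $ k) + e i) \<Longrightarrow>
          x $ l = (\<Sum>k\<in>UNIV. A l k * e k)"
      and A_diag: "\<And>l. l \<in> pa B j \<Longrightarrow> A l l = 1"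
      and A_support: "\<And>l k. l \<in> pa B j \<Longrightarrow> A l k \<noteq> 0 \<Longrightarrow> (k, l) \<in> (edges B)\<^sup>*"
      by blast+
    \<comment> \<open>The sum collects what the errors contribute through the parents of
      \<open>j\<close>; the last summand is the error of \<open>j\<close> itself.\<close>
    define c where "c k = (\<Sum>l\<in>pa B j. B $ j $ l * A l k) + (if k = j then 1 else 0)" for k
    \<comment> \<open>A path from \<open>j\<close> to \<open>l\<close> followed by the edge from
      \<open>l\<close> to \<open>j\<close> would be a cycle. The empty path is included, so
      \<open>j\<close> is not its own parent.\<close>
    have no_loop: "(j, l) \<notin> (edges B)\<^sup>*" if "l \<in> pa B j" for l
      using that acyc by (auto simp: pa_def acyclic_def intro: rtrancl_into_trancl1)
    have solution: "x $ j = (\<Sum>k\<in>UNIV. c k * e k)"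
      if eq: "\<forall>i. x $ i = (\<Sum>k\<in>UNIV - {i}. B $ i $ k * x $ k) + e i" for x :: "real ^ 'p" and e
    proof -
      have "pa B j \<subseteq> UNIV - {j}"
        using no_loop by auto
      then have "(\<Sum>k\<in>UNIV - {j}. B $ j $ k * x $ k) = (\<Sum>l\<in>pa B j. B $ j $ l * x $ l)"
        by (intro sum.mono_neutral_right) (auto simp: pa_def edges_def)
      also have "\<dots> = (\<Sum>l\<in>pa B j. \<Sum>k\<in>UNIV. B $ j $ l * A l k * e k)"
        using A_solution[OF _ eq] by (intro sum.cong) (simp_all add: sum_distrib_left mult.assoc)
      also have "\<dots> = (\<Sum>k\<in>UNIV. (\<Sum>l\<in>pa B j. B $ j $ l * A l k) * e k)"
        by (subst sum.swap) (simp add: sum_distrib_right)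
      finally have "x $ j = (\<Sum>k\<in>UNIV. (\<Sum>l\<in>pa B j. B $ j $ l * A l k) * e k) + e j"
        using eq[rule_format, of j] by (simp only:)
      also have "e j = (\<Sum>k\<in>UNIV. (if k = j then 1 else 0) * e k)"
        by (simp add: if_distrib[of "\<lambda>u. u * _"] cong: if_cong)
      finally show ?thesis
        by (simp add: c_def distrib_right sum.distrib)
    qed
    have "A l j = 0" if "l \<in> pa B j" for l
      using A_support[OF that] no_loop[OF that] by blast
    then have diag: "c j = 1"
      by (simp add: c_def)
    have support: "(k, j) \<in> (edges B)\<^sup>*" if "c k \<noteq> 0" for k
    proof (cases "k = j")
      case False
      then have "(\<Sum>l\<in>pa B j. B $ j $ l * A l k) \<noteq> 0"
        using that by (simp add: c_def)
      then obtain l where l: "l \<in> pa B j" "A l k \<noteq> 0"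
        by (elim sum.not_neutral_contains_not_neutral) auto
      then have "(k, l) \<in> (edges B)\<^sup>*"
        using A_support by blast
      then show ?thesis
        using l by (auto simp: pa_def)
    qed simp
    have parent: "\<exists>k\<in>pa B j. c k = B $ j $ k" if nonempty: "pa B j \<noteq> {}"
    proof -
      \<comment> \<open>The transitive closure is used so that the chosen parent \<open>k\<close>
        has no path to another parent, not even one through vertices outside
        \<open>pa B j\<close>.\<close>
      have "wf (((edges B)\<^sup>+)\<inverse>)"
        using acyc by (intro finite_acyclic_wf_converse) (auto simp: acyclic_def)
      then obtain k where k: "k \<in> pa B j" "\<And>l. (k, l) \<in> (edges B)\<^sup>+ \<Longrightarrow> l \<notin> pa B j"
        using nonempty by (elim wfE_min'[where Q = "pa B j"]) auto
      \<comment> \<open>A nonzero \<open>A l k\<close> with \<open>l \<noteq> k\<close> would give a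
        nonempty path from \<open>k\<close> to the parent \<open>l\<close>, against the choice of
        \<open>k\<close>.\<close>
      have "A l k = 0" if "l \<in> pa B j - {k}" for l
        using that A_support[of l k] k(2)[of l] by (auto dest: rtranclD)
      then have "(\<Sum>l\<in>pa B j. B $ j $ l * A l k) = B $ j $ k * A k k"
        using k(1) by (subst sum.remove[of _ k]) auto
      moreover have "k \<noteq> j"
        using no_loop[OF k(1)] by auto
      ultimately have "c k = B $ j $ k"
        using A_diag[OF k(1)] by (simp add: c_def)
      then show ?thesis
        using k(1) by blast
    qed
    show ?case
      using solution diag support parent by blast
  qed
qed

lemma zeta_le:
  fixes B :: "real ^ ('p::finite) ^ 'p"
  assumes "k \<in> pa B j"
  shows "zeta B \<le> (B $ j $ k)\<^sup>2"
  unfolding zeta_def using assms by (intro Min_le) (force simp: pa_def)+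

lemma zeta_pos:
  fixes B :: "real ^ ('p::finite) ^ 'p"
  assumes "edges B \<noteq> {}"
  shows "zeta B > 0"
  unfolding zeta_def using assms by (subst Min_gr_iff) (auto simp: edges_def)

theorem lemma1:
  fixes M :: "'a measure" and X :: "'a \<Rightarrow> real ^ ('p::finite)"
    and B :: "real ^ 'p ^ 'p" and \<sigma> :: real and j :: 'p
  assumes "prob_space M"
    and "prob_space.equal_var_sem M X B (\<sigma>\<^sup>2)"
    and "acyclic (edges B)"
  shows "(pa B j = {} \<longrightarrow> prob_space.variance M (\<lambda>\<omega>. X \<omega> $ j) = \<sigma>\<^sup>2) \<and>
         (pa B j \<noteq> {} \<longrightarrow>
            prob_space.variance M (\<lambda>\<omega>. X \<omega> $ j) \<ge> \<sigma>\<^sup>2 * (1 + zeta B) \<and>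
            \<sigma>\<^sup>2 * (1 + zeta B) > \<sigma>\<^sup>2)"
proof -
  interpret prob_space M by fact
  obtain \<epsilon> :: "'p \<Rightarrow> 'a \<Rightarrow> real" where v: "\<sigma>\<^sup>2 > 0" and X[measurable]: "random_variable borel X"
    and indep: "indep_vars (\<lambda>_. borel) \<epsilon> UNIV"
    and \<epsilon>: "\<And>i. integrable M (\<epsilon> i)" "\<And>i. integrable M (\<lambda>\<omega>. (\<epsilon> i \<omega>)\<^sup>2)"
      "\<And>i. expectation (\<epsilon> i) = 0" "\<And>i. variance (\<epsilon> i) = \<sigma>\<^sup>2"
    and sem: "AE \<omega> in M. \<forall>i. X \<omega> $ i = (\<Sum>k\<in>UNIV - {i}. B $ i $ k * X \<omega> $ k) + \<epsilon> i \<omega>"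
    using assms(2) unfolding equal_var_sem_def by blast
  obtain c :: "'p \<Rightarrow> real" where
    sol: "\<And>(x :: real ^ 'p) e. (\<forall>i. x $ i = (\<Sum>k\<in>UNIV - {i}. B $ i $ k * x $ k) + e i)
            \<Longrightarrow> x $ j = (\<Sum>k\<in>UNIV. c k * e k)"
    and diag: "c j = 1" and support: "\<And>k. c k \<noteq> 0 \<Longrightarrow> (k, j) \<in> (edges B)\<^sup>*"
    and parent: "pa B j \<noteq> {} \<Longrightarrow> \<exists>k\<in>pa B j. c k = B $ j $ k"
    using acyclic_structural_equations_solution[OF assms(3), of j] by blast
  have [measurable]: "\<epsilon> i \<in> borel_measurable M" for i
    using \<epsilon>(1) by auto
  have [measurable]: "(\<lambda>\<omega>. X \<omega> $ j) \<in> borel_measurable M"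
    using measurable_compose[OF X borel_measurable_continuous_onI[of "\<lambda>x. x $ j"]]
    by (simp add: continuous_on_component)
  \<comment> \<open>The deterministic solution is applied outcome by outcome wherever the structural
    equations hold.\<close>
  have AE_eq: "AE \<omega> in M. X \<omega> $ j = (\<Sum>k\<in>UNIV. c k * \<epsilon> k \<omega>)"
    using sem by eventually_elim (rule sol)
  \<comment> \<open>The variance contains the mean as centering constant, so the means are matched
    before the squared deviations are compared.\<close>
  have mean: "expectation (\<lambda>\<omega>. X \<omega> $ j) = expectation (\<lambda>\<omega>. \<Sum>k\<in>UNIV. c k * \<epsilon> k \<omega>)"
    using AE_eq by (intro integral_cong_AE) auto
  have "variance (\<lambda>\<omega>. X \<omega> $ j) = variance (\<lambda>\<omega>. \<Sum>k\<in>UNIV. c k * \<epsilon> k \<omega>)"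
    unfolding mean using AE_eq by (intro integral_cong_AE) auto
  then have var: "variance (\<lambda>\<omega>. X \<omega> $ j) = \<sigma>\<^sup>2 * (\<Sum>k\<in>UNIV. (c k)\<^sup>2)"
    using indep_vars_linear_combination(2)[OF finite indep, of "\<sigma>\<^sup>2" c] \<epsilon> by simp
  show ?thesis
  proof (intro conjI impI)
    assume "pa B j = {}"
    \<comment> \<open>A nonempty path ending in \<open>j\<close> would have a last edge, whose
      source is a parent of \<open>j\<close>.\<close>
    then have "c k = 0" if "k \<noteq> j" for k
      using support[of k] that by (auto simp: pa_def elim: rtranclE)
    then have "(\<Sum>k\<in>UNIV. (c k)\<^sup>2) = (\<Sum>k\<in>{j}. (c k)\<^sup>2)"
      by (intro sum.mono_neutral_right) auto
    then show "variance (\<lambda>\<omega>. X \<omega> $ j) = \<sigma>\<^sup>2"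
      using var diag by simp
  next
    assume "pa B j \<noteq> {}"
    then obtain k where k: "k \<in> pa B j" "c k = B $ j $ k"
      using parent by blast
    then have "k \<noteq> j"
      using assms(3) by (auto simp: pa_def acyclic_def)
    \<comment> \<open>Only the squares for \<open>j\<close> and for the distinguished parent are
      kept; all others are nonnegative.\<close>
    then have "1 + (c k)\<^sup>2 = (\<Sum>i\<in>{j, k}. (c i)\<^sup>2)"
      using diag by simp
    also have "\<dots> \<le> (\<Sum>i\<in>UNIV. (c i)\<^sup>2)"
      by (intro sum_mono2) auto
    finally have "1 + zeta B \<le> (\<Sum>i\<in>UNIV. (c i)\<^sup>2)"
      using zeta_le[OF k(1)] k(2) by simp
    then show "variance (\<lambda>\<omega>. X \<omega> $ j) \<ge> \<sigma>\<^sup>2 * (1 + zeta B)"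
      unfolding var using v by (intro mult_left_mono) auto
  next
    assume "pa B j \<noteq> {}"
    \<comment> \<open>A parent of \<open>j\<close> supplies an edge, so \<open>zeta B\<close> is a
      minimum over a finite nonempty set of positive squares.\<close>
    then have "zeta B > 0"
      by (intro zeta_pos) (auto simp: pa_def)
    then show "\<sigma>\<^sup>2 * (1 + zeta B) > \<sigma>\<^sup>2"
      using v by (simp add: distrib_left)
  qed
qed

end
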